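(* Let $\mathcal{I}$ be a proper ideal on a set $X$ with $\mathcal{I}\neq\{\emptyset\}$. Then $\mathcal{I}$ is a minimal ideal if and only if $A=B$ for all $A,B\in\mathcal{I}\setminus\{\emptyset\}$.
   Context: An ideal on a set $X$ is a non-empty family $\mathcal{I}\subseteq 2^X$ ($2^X$ is the power set of $X$) such that (i) $A\in\mathcal{I}$ and $B\subseteq A$ imply $B\in\mathcal{I}$, and (ii) $A,B\in\mathcal{I}$ imply $A\cup B\in\mathcal{I}$. An ideal $\mathcal{I}$ is proper if $\mathcal{I}\neq 2^X$. A proper ideal $\mathcal{I}\neq\{\emptyset\}$ on $X$ is a minimal ideal if for every ideal $\mathcal{J}$ on $X$ with $\mathcal{J}\subseteq\mathcal{I}$, one has $\mathcal{J}=\mathcal{I}$ or $\mathcal{J}=\{\emptyset\}$. *)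

theory Defs
  imports Main
begin

definition ideal_on :: "'a set \<Rightarrow> 'a set set \<Rightarrow> bool" where
  "ideal_on X \<I> \<longleftrightarrow>
     \<I> \<noteq> {} \<and> \<I> \<subseteq> Pow X \<and>
     (\<forall>A B. A \<in> \<I> \<longrightarrow> B \<subseteq> A \<longrightarrow> B \<in> \<I>) \<and>
     (\<forall>A B. A \<in> \<I> \<longrightarrow> B \<in> \<I> \<longrightarrow> A \<union> B \<in> \<I>)"

definition proper_ideal_on :: "'a set \<Rightarrow> 'a set set \<Rightarrow> bool" where
  "proper_ideal_on X \<I> \<longleftrightarrow> ideal_on X \<I> \<and> \<I> \<noteq> Pow X"

definition minimal_ideal_on :: "'a set \<Rightarrow> 'a set set \<Rightarrow> bool" where
  "minimal_ideal_on X \<I> \<longleftrightarrow>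
     proper_ideal_on X \<I> \<and> \<I> \<noteq> {{}} \<and>
     (\<forall>\<J>. ideal_on X \<J> \<longrightarrow> \<J> \<subseteq> \<I> \<longrightarrow> \<J> = \<I> \<or> \<J> = {{}})"

end

theory Submission
  imports Defs
begin

text \<open>
  Every member \<open>A\<close> of an ideal \<open>\<I>\<close> generates the principal ideal \<open>Pow A \<subseteq> \<I>\<close>, which is nontrivial
  as soon as \<open>A \<noteq> {}\<close>. If \<open>\<I>\<close> is minimal, it therefore coincides with \<open>Pow A\<close> for each of its
  nonempty members \<open>A\<close>, and \<open>A\<close> is recovered from \<open>Pow A\<close> as its largest element, so there is only
  one such \<open>A\<close>. Conversely, if \<open>\<I>\<close> has a single nonempty member, then an ideal inside \<open>\<I>\<close> either
  misses that member, and is trivial, or contains it, and is all of \<open>\<I>\<close>.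
\<close>

lemma empty_in_ideal:
  assumes "ideal_on X \<I>"
  shows "{} \<in> \<I>"
  using assms unfolding ideal_on_def by blast

lemma ideal_on_Pow:
  assumes "A \<subseteq> X"
  shows "ideal_on X (Pow A)"
  using assms unfolding ideal_on_def by blast

lemma Pow_subset_ideal:
  assumes "ideal_on X \<I>" and "A \<in> \<I>"
  shows "Pow A \<subseteq> \<I>"
  using assms unfolding ideal_on_def by blast

text \<open>Minimality is tested against the principal ideal generated by \<open>A\<close>.\<close>

lemma minimal_ideal_eq_Pow:
  assumes min: "minimal_ideal_on X \<I>" and A: "A \<in> \<I>" "A \<noteq> {}"
  shows "\<I> = Pow A"
proof -
  have ideal: "ideal_on X \<I>"
    using min by (simp add: minimal_ideal_on_def proper_ideal_on_def)
  then have "A \<subseteq> X"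
    using A(1) by (auto simp: ideal_on_def)
  then have "Pow A = \<I> \<or> Pow A = {{}}"
    using min ideal_on_Pow[of A X] Pow_subset_ideal[OF ideal A(1)]
    unfolding minimal_ideal_on_def by metis
  then show ?thesis
    using A(2) by blast
qed

theorem theorem3p8:
  fixes X :: "'a set" and \<I> :: "'a set set"
  assumes "proper_ideal_on X \<I>" and "\<I> \<noteq> {{}}"
  shows "minimal_ideal_on X \<I> \<longleftrightarrow> (\<forall>A\<in>\<I> - {{}}. \<forall>B\<in>\<I> - {{}}. A = B)"
proof
  assume min: "minimal_ideal_on X \<I>"
  show "\<forall>A\<in>\<I> - {{}}. \<forall>B\<in>\<I> - {{}}. A = B"
  proof (intro ballI)
    fix A B
    assume "A \<in> \<I> - {{}}" and "B \<in> \<I> - {{}}"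
    then have "Pow A = Pow B"
      using minimal_ideal_eq_Pow[OF min, of A] minimal_ideal_eq_Pow[OF min, of B] by simp
    then show "A = B"
      by (metis Pow_top Pow_iff subset_antisym)
  qed
next
  assume unique: "\<forall>A\<in>\<I> - {{}}. \<forall>B\<in>\<I> - {{}}. A = B"
  have "\<J> = \<I>" if \<J>: "ideal_on X \<J>" "\<J> \<subseteq> \<I>" "\<J> \<noteq> {{}}" for \<J>
  proof
    have empty: "{} \<in> \<J>"
      using \<J>(1) by (rule empty_in_ideal)
    then obtain A where A: "A \<in> \<J>" "A \<noteq> {}"
      using \<J>(3) by blast
    show "\<I> \<subseteq> \<J>"
    proof
      fix B
      assume "B \<in> \<I>"
      show "B \<in> \<J>"
      proof (cases "B = {}")
        case True
        then show ?thesis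
          using empty by simp
      next
        case False
        then have "B = A"
          using unique A \<J>(2) \<open>B \<in> \<I>\<close> by (simp add: subset_eq)
        then show ?thesis
          using A(1) by simp
      qed
    qed
  qed (rule \<J>(2))
  then show "minimal_ideal_on X \<I>"
    using assms by (auto simp: minimal_ideal_on_def)
qed

end
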